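(* For every group $G$ (of arbitrary cardinality), there is a right-invariant metric $d$ on $G$ satisfying $$\mathrm{Isom}(G,d)=\Xi(G),\qquad \mathrm{im}(d)\subseteq\{0\}\cup\{1+2^{-j}: j\in\mathbb Z,\ j\ge 1\}.$$ The metric is bounded, uniformly discrete, and complete.
   Context: Groups are abstract (no topology). A metric $d$ on $G$ is right-invariant if $d(xg,yg)=d(x,y)$ for all $x,y,g\in G$. An isometry is a surjective distance-preserving map; $\mathrm{Isom}(G,d)$ is the group of isometries of $(G,d)$ onto itself. For $g\in G$ put $[g]=\{g,g^{-1}\}$, and $$\Xi(G)=\{F\in\mathrm{Sym}(G): [F(x)F(y)^{-1}]=[xy^{-1}]\text{ for all }x,y\in G\}.$$ A metric is uniformly discrete if its nonzero distances have a positive lower bound. Work in ZFC. *)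

theory Defs
  imports "HOL-Analysis.Analysis" "HOL-Algebra.Bij"
begin

definition right_invariant :: "('a, 'b) monoid_scheme \<Rightarrow> ('a \<Rightarrow> 'a \<Rightarrow> real) \<Rightarrow> bool" where
  "right_invariant G d \<longleftrightarrow>
    (\<forall>x\<in>carrier G. \<forall>y\<in>carrier G. \<forall>g\<in>carrier G. d (x \<otimes>\<^bsub>G\<^esub> g) (y \<otimes>\<^bsub>G\<^esub> g) = d x y)"

text \<open>A self-map of a set \<open>M\<close> is represented by a function that is \<^const>\<open>undefined\<close> outside
  \<open>M\<close>, as in \<^const>\<open>Bij\<close>; the equality of sets of self-maps below is therefore equality of
  their restrictions to \<open>M\<close>.\<close>

definition Isom :: "'a set \<Rightarrow> ('a \<Rightarrow> 'a \<Rightarrow> real) \<Rightarrow> ('a \<Rightarrow> 'a) set" where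
  "Isom M d = {F \<in> extensional M. F ` M = M \<and> (\<forall>x\<in>M. \<forall>y\<in>M. d (F x) (F y) = d x y)}"

definition inv_class :: "('a, 'b) monoid_scheme \<Rightarrow> 'a \<Rightarrow> 'a set" where
  "inv_class G g = {g, inv\<^bsub>G\<^esub> g}"

definition Xi :: "('a, 'b) monoid_scheme \<Rightarrow> ('a \<Rightarrow> 'a) set" where
  "Xi G = {F \<in> Bij (carrier G). \<forall>x\<in>carrier G. \<forall>y\<in>carrier G.
     inv_class G (F x \<otimes>\<^bsub>G\<^esub> inv\<^bsub>G\<^esub> (F y)) = inv_class G (x \<otimes>\<^bsub>G\<^esub> inv\<^bsub>G\<^esub> y)}"

definition uniformly_discrete :: "'a set \<Rightarrow> ('a \<Rightarrow> 'a \<Rightarrow> real) \<Rightarrow> bool" where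
  "uniformly_discrete M d \<longleftrightarrow> (\<exists>c>0. \<forall>x\<in>M. \<forall>y\<in>M. d x y \<noteq> 0 \<longrightarrow> c \<le> d x y)"

end

theory Submission
  imports Defs "HOL-Algebra.Generated_Groups"
begin

text \<open>All distances between distinct points lie in \<open>[1, 2]\<close>, so the triangle inequality is free and
  the task is to colour \<open>G\<close> with countably many colours, constant on the classes
  \<open>[g] = {g, inv g}\<close>, such that every permutation \<open>F\<close> that fixes the identity and preserves the
  colours of all quotients \<open>x \<otimes> inv y\<close> satisfies \<open>F g \<in> [g]\<close> for all \<open>g\<close>. The colouring is a product
  of two. Well-order \<open>G\<close> and keep the elements not generated by their predecessors: these generate
  \<open>G\<close>, and finitely many colours, recording membership in this generating set and a parity that
  alternates along the well-order, already force \<open>F x \<in> [x]\<close> for each generator \<open>x\<close>. If then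
  \<open>g = x \<otimes> h\<close> with \<open>x\<close> a generator and \<open>h\<close> a shorter word, induction leaves finitely many candidates
  for \<open>F g\<close>, and a digraph of finite out-degrees is countably colourable, so countably many further
  colours separate the wrong candidates from \<open>g\<close>.\<close>

section \<open>Well-orders, digraph colourings and alternating parities\<close>

lemma well_order_UNIV_strict:
  obtains r :: "'a rel"
  where "wf r" "trans r" "\<And>x y. x \<noteq> y \<Longrightarrow> (x, y) \<in> r \<or> (y, x) \<in> r"
proof -
  obtain w :: "'a rel" where w: "well_order_on UNIV w"
    using well_order_on by blast
  show thesis
  proof
    show "wf (w - Id)"
      using w by (simp add: well_order_on_def)
    show "trans (w - Id)"
      using w trans_diff_Id
      by (auto simp: well_order_on_def linear_order_on_def partial_order_on_def preorder_on_def)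
    show "(x, y) \<in> w - Id \<or> (y, x) \<in> w - Id" if "x \<noteq> y" for x y
      using w that by (auto simp: well_order_on_def linear_order_on_def total_on_def)
  qed
qed

text \<open>Every vertex lies in the countable set of vertices reachable from some vertex \<open>z\<close>; pick the
  least such \<open>z\<close> in a well-order. Edges never increase it, and the vertices sharing one \<open>z\<close> are
  countably many. So colour recursively on \<open>z\<close>: the colour lies in an infinite set attached to the
  index of the vertex among its peers and avoids the finitely many colours of earlier
  out-neighbours.\<close>

lemma finite_outdegree_imp_countable_colouring:
  fixes f :: "'a \<Rightarrow> 'a set"
  assumes "\<And>x. finite (f x)"
  obtains c :: "'a \<Rightarrow> nat" where "\<And>x y. y \<in> f x \<Longrightarrow> y \<noteq> x \<Longrightarrow> c y \<noteq> c x"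
proof -
  obtain r :: "'a rel" where r: "wf r" "\<And>x y. x \<noteq> y \<Longrightarrow> (x, y) \<in> r \<or> (y, x) \<in> r"
    using well_order_UNIV_strict by metis
  define E where "E = {(x, y). y \<in> f x}"
  define reach where "reach z = E\<^sup>* `` {z}" for z
  have "countable (E `` Y)" if "countable Y" for Y
  proof -
    have "E `` Y = (\<Union>y\<in>Y. f y)"
      by (auto simp: E_def)
    then show ?thesis
      using that assms by (simp add: countable_finite)
  qed
  then have countable_reach: "countable (reach z)" for z
    unfolding reach_def by (intro countable_rtrancl) auto
  have "\<exists>z. x \<in> reach z \<and> (\<forall>y. (y, z) \<in> r \<longrightarrow> x \<notin> reach y)" for x
    using wfE_min[OF r(1), of x "{z. x \<in> reach z}"] by (auto simp: reach_def)
  then obtain root where root: "\<And>x. x \<in> reach (root x)"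
    and least: "\<And>x y. (y, root x) \<in> r \<Longrightarrow> x \<notin> reach y"
    by metis
  have root_edge: "(root y, root x) \<in> r" if "y \<in> f x" "root y \<noteq> root x" for x y
  proof -
    have "y \<in> reach (root x)"
      using root[of x] that(1) by (auto simp: reach_def E_def intro: rtrancl_into_rtrancl)
    then show ?thesis
      using least r(2) that(2) by blast
  qed
  define idx where "idx x = to_nat_on (reach (root x)) x" for x
  have "\<exists>c. \<forall>x. c x \<in> range (\<lambda>m. prod_encode (idx x, m)) -
      c ` {y \<in> f x. (root y, root x) \<in> r}"
  proof (rule dependent_wf_choice[where R = "inv_image r root"], goal_cases)
    case 1
    show ?case
      using r(1) by (rule wf_inv_image)
  next
    case (2 c c' x v)
    then have "c ` {y \<in> f x. (root y, root x) \<in> r} = c' ` {y \<in> f x. (root y, root x) \<in> r}"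
      by (intro image_cong) auto
    then show ?case
      by simp
  next
    case (3 x c)
    have "infinite (range (\<lambda>m. prod_encode (idx x, m)))"
      by (intro range_inj_infinite) (auto simp: inj_def)
    moreover have "finite (c ` {y \<in> f x. (root y, root x) \<in> r})"
      using assms by simp
    ultimately have "infinite (range (\<lambda>m. prod_encode (idx x, m)) -
        c ` {y \<in> f x. (root y, root x) \<in> r})"
      by simp
    then show ?case
      by (metis ex_in_conv finite.emptyI)
  qed
  then obtain c where c: "\<And>x. c x \<in> range (\<lambda>m. prod_encode (idx x, m))"
    "\<And>x. c x \<notin> c ` {y \<in> f x. (root y, root x) \<in> r}"
    by blast
  show thesis
  proof
    fix x y
    assume "y \<in> f x" "y \<noteq> x"
    show "c y \<noteq> c x"
    proof (cases "root y = root x")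
      case True
      have "idx y \<noteq> idx x"
        using \<open>y \<noteq> x\<close> root[of x] root[of y] countable_reach by (simp add: idx_def True)
      then show ?thesis
        using c(1)[of x] c(1)[of y] by (auto simp: inj_on_def)
    next
      case False
      then show ?thesis
        using c(2)[of x] root_edge[OF \<open>y \<in> f x\<close> False] \<open>y \<in> f x\<close>
        by (metis (mono_tags, lifting) CollectI imageI)
    qed
  qed
qed

text \<open>By totality an element of \<open>X\<close> has at most one immediate predecessor within
  \<open>X\<close>, so recursion along \<open>r\<close> meets at most one constraint at each point.
  Where there is none, as at limits, the value is arbitrary.\<close>

lemma wf_alternating:
  assumes "wf r" and r_total: "\<And>x y. x \<noteq> y \<Longrightarrow> (x, y) \<in> r \<or> (y, x) \<in> r"
  obtains p :: "'a \<Rightarrow> bool"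
  where "\<And>x y. x \<in> X \<Longrightarrow> y \<in> X \<Longrightarrow> (x, y) \<in> r \<Longrightarrow>
    (\<And>z. z \<in> X \<Longrightarrow> (x, z) \<in> r \<Longrightarrow> (z, y) \<notin> r) \<Longrightarrow> p y \<noteq> p x"
proof -
  define R where "R = {(x, y) \<in> r. x \<in> X \<and> y \<in> X \<and> (\<forall>z\<in>X. (x, z) \<in> r \<longrightarrow> (z, y) \<notin> r)}"
  have "\<exists>p :: 'a \<Rightarrow> bool. \<forall>y. \<forall>x. (x, y) \<in> R \<longrightarrow> p y \<noteq> p x"
  proof (rule dependent_wf_choice[where R = R], goal_cases)
    case 1
    show ?case
      using \<open>wf r\<close> by (rule wf_subset) (auto simp: R_def)
  next
    case (2 p p' y v)
    then show ?case
      by auto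
  next
    case (3 y p)
    have "x = x'" if "(x, y) \<in> R" "(x', y) \<in> R" for x x'
      using that r_total[of x x'] by (auto simp: R_def)
    then have "\<exists>r. \<forall>x. (x, y) \<in> R \<longrightarrow> p x = (\<not> r)"
      by (metis (full_types))
    then show ?case
      by auto
  qed
  then obtain p :: "'a \<Rightarrow> bool" where p: "\<And>x y. (x, y) \<in> R \<Longrightarrow> p y \<noteq> p x"
    by blast
  show thesis
    by (rule that, rule p) (auto simp: R_def)
qed

section \<open>Inversion classes and words over a generating set\<close>

context group
begin

lemma inv_class_subset_carrier: "g \<in> carrier G \<Longrightarrow> inv_class G g \<subseteq> carrier G"
  by (auto simp: inv_class_def)

lemma self_in_inv_class: "g \<in> inv_class G g"
  by (simp add: inv_class_def)

lemma inv_class_eq: "g \<in> carrier G \<Longrightarrow> h \<in> inv_class G g \<Longrightarrow> inv_class G h = inv_class G g"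
  by (auto simp: inv_class_def)

lemma mult_inv_mult_cancel:
  assumes "x \<in> carrier G" "y \<in> carrier G" "a \<in> carrier G"
  shows "(x \<otimes> a) \<otimes> inv (y \<otimes> a) = x \<otimes> inv y"
proof -
  have "a \<otimes> (inv a \<otimes> inv y) = inv y"
    using assms by (simp add: m_assoc[symmetric])
  then show ?thesis
    using assms by (simp add: inv_mult_group m_assoc)
qed

lemma generate_mono_closure:
  assumes "H \<subseteq> generate G K" "K \<subseteq> carrier G"
  shows "generate G H \<subseteq> generate G K"
  using assms by (intro generate_subgroup_incl generate_is_subgroup)

text \<open>\<open>len\<close> is the length of a shortest word over \<open>S\<close>, and
  \<open>s g\<close> is the first letter of such a word. Closure under inverses makes products of
  elements of \<open>S\<close> exhaust the generated group.\<close>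

lemma word_decomposition:
  assumes S: "S \<subseteq> carrier G" "\<And>s. s \<in> S \<Longrightarrow> inv s \<in> S" and gen: "generate G S = carrier G"
  obtains len :: "'a \<Rightarrow> nat" and s t
  where "\<And>g. g \<in> carrier G \<Longrightarrow> g \<noteq> \<one> \<Longrightarrow>
    s g \<in> S \<and> t g \<in> carrier G \<and> g = s g \<otimes> t g \<and> len (t g) < len g"
proof -
  define W where "W = rec_nat {\<one>} (\<lambda>_ A. {x \<otimes> g |x g. x \<in> S \<and> g \<in> A})"
  have W_0: "W 0 = {\<one>}" and W_Suc: "W (Suc n) = {x \<otimes> g |x g. x \<in> S \<and> g \<in> W n}" for n
    by (auto simp: W_def)
  have W_carrier: "W n \<subseteq> carrier G" for n
    using S(1) by (induction n) (auto simp: W_0 W_Suc)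
  have W_add: "a \<otimes> b \<in> W (m + n)" if "a \<in> W m" "b \<in> W n" for a b m n
    using that(1)
  proof (induction m arbitrary: a)
    case 0
    then show ?case
      using that(2) W_carrier[of n] by (auto simp: W_0)
  next
    case (Suc m)
    then obtain x g where "a = x \<otimes> g" "x \<in> S" "g \<in> W m"
      by (auto simp: W_Suc)
    moreover have "x \<otimes> g \<otimes> b = x \<otimes> (g \<otimes> b)"
      using calculation S(1) W_carrier that(2) by (meson m_assoc subsetD)
    ultimately show ?case
      using Suc.IH by (auto simp: W_Suc)
  qed
  have W_1: "x \<in> W (Suc 0)" if "x \<in> S" for x
    using that S(1) by (force simp: W_0 W_Suc)
  have "\<exists>n. g \<in> W n" if "g \<in> generate G S" for g
    using that
  proof induction
    case one
    then show ?case
      using W_0 by blast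
  qed (use W_1 W_add S(2) in blast)+
  then have W_ex: "\<exists>n. g \<in> W n" if "g \<in> carrier G" for g
    using that gen by blast
  define len where "len g = (LEAST n. g \<in> W n)" for g
  have "\<exists>x h. x \<in> S \<and> h \<in> carrier G \<and> g = x \<otimes> h \<and> len h < len g"
    if g: "g \<in> carrier G" "g \<noteq> \<one>" for g
  proof -
    have "g \<in> W (len g)"
      using W_ex[OF g(1)] unfolding len_def by (auto intro: LeastI)
    then obtain n where n: "len g = Suc n" "g \<in> W (Suc n)"
      using g(2) W_0 by (cases "len g") auto
    then obtain x h where "x \<in> S" "h \<in> W n" "g = x \<otimes> h"
      by (auto simp: W_Suc)
    moreover have "len h \<le> n"
      unfolding len_def by (rule Least_le) fact
    ultimately show ?thesis
      using n(1) W_carrier[of n] by (intro exI[of _ x] exI[of _ h]) auto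
  qed
  then show thesis
    using that by metis
qed

subsection \<open>Colour-preserving permutations\<close>

text \<open>Colouring the pair \<open>(x, y)\<close> by \<open>c (x \<otimes> inv y)\<close> gives a
  Cayley colour digraph on which right translations act transitively by automorphisms. Hence it
  suffices to study the stabiliser of the identity.\<close>

definition colour_stab :: "('a \<Rightarrow> 'c) \<Rightarrow> ('a \<Rightarrow> 'a) set" where
  "colour_stab c = {F. bij_betw F (carrier G) (carrier G) \<and> F \<one> = \<one> \<and>
     (\<forall>x\<in>carrier G. \<forall>y\<in>carrier G. c (F x \<otimes> inv (F y)) = c (x \<otimes> inv y))}"

text \<open>The goal is a colouring with \<open>rigid c = carrier G\<close>; translation then turns
  this condition at the identity into the condition on all pairs in \<open>Xi G\<close>.\<close>

definition rigid :: "('a \<Rightarrow> 'c) \<Rightarrow> 'a set" where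
  "rigid c = {g \<in> carrier G. \<forall>F\<in>colour_stab c. F g \<in> inv_class G g}"

lemma rigidD: "g \<in> rigid c \<Longrightarrow> F \<in> colour_stab c \<Longrightarrow> F g \<in> inv_class G g"
  by (simp add: rigid_def)

lemma colour_stab_closed: "F \<in> colour_stab c \<Longrightarrow> x \<in> carrier G \<Longrightarrow> F x \<in> carrier G"
  by (auto simp: colour_stab_def bij_betw_def)

lemma colour_stab_colour:
  assumes "F \<in> colour_stab c" "x \<in> carrier G"
  shows "c (F x) = c x"
proof -
  have "c (F x \<otimes> inv (F \<one>)) = c (x \<otimes> inv \<one>)"
    using assms one_closed unfolding colour_stab_def by blast
  moreover have "F \<one> = \<one>"
    using assms(1) by (simp add: colour_stab_def)
  ultimately show ?thesis
    using assms by (simp add: colour_stab_closed)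
qed

text \<open>Inverses allow facts about images of generators to be applied to preimages as
  well.\<close>

lemma colour_stab_inv_into:
  assumes F: "F \<in> colour_stab c"
  shows "inv_into (carrier G) F \<in> colour_stab c"
proof -
  let ?H = "inv_into (carrier G) F"
  have bij: "bij_betw F (carrier G) (carrier G)"
    using F by (simp add: colour_stab_def)
  have H: "bij_betw ?H (carrier G) (carrier G)"
    by (rule bij_betw_inv_into[OF bij])
  have "?H \<one> = \<one>"
    using F bij_betw_inv_into_left[OF bij, of \<one>] by (simp add: colour_stab_def)
  moreover have "c (?H x \<otimes> inv (?H y)) = c (x \<otimes> inv y)"
    if "x \<in> carrier G" "y \<in> carrier G" for x y
  proof -
    have "?H x \<in> carrier G" "?H y \<in> carrier G"
      using H that by (auto simp: bij_betw_def)
    then have "c (F (?H x) \<otimes> inv (F (?H y))) = c (?H x \<otimes> inv (?H y))"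
      using F by (simp add: colour_stab_def)
    then show ?thesis
      using bij_betw_inv_into_right[OF bij] that by simp
  qed
  ultimately show ?thesis
    using H by (simp add: colour_stab_def)
qed

text \<open>Right translations leave every quotient unchanged, so composing with them on either side
  keeps the colours. The factor \<open>inv (F a)\<close> brings the image of the identity back to
  the identity.\<close>

lemma colour_stab_translate:
  assumes bij: "bij_betw F (carrier G) (carrier G)"
    and c: "\<And>x y. x \<in> carrier G \<Longrightarrow> y \<in> carrier G \<Longrightarrow> c (F x \<otimes> inv (F y)) = c (x \<otimes> inv y)"
    and a: "a \<in> carrier G"
  shows "(\<lambda>x. F (x \<otimes> a) \<otimes> inv (F a)) \<in> colour_stab c"
proof -
  have closed: "F x \<in> carrier G" if "x \<in> carrier G" for x
    using bij that by (auto simp: bij_betw_def)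
  have translation: "bij_betw (\<lambda>x. x \<otimes> b) (carrier G) (carrier G)" if "b \<in> carrier G" for b
    by (rule bij_betw_byWitness[where f' = "\<lambda>x. x \<otimes> inv b"]) (use that in \<open>auto simp: m_assoc\<close>)
  have "bij_betw ((\<lambda>x. x \<otimes> inv (F a)) \<circ> (F \<circ> (\<lambda>x. x \<otimes> a))) (carrier G) (carrier G)"
    using translation[of a] translation[of "inv (F a)"] bij a closed
    by (blast intro: bij_betw_trans inv_closed)
  moreover have "c (F (x \<otimes> a) \<otimes> inv (F a) \<otimes> inv (F (y \<otimes> a) \<otimes> inv (F a))) = c (x \<otimes> inv y)"
    if "x \<in> carrier G" "y \<in> carrier G" for x y
    using that a closed c[of "x \<otimes> a" "y \<otimes> a"] by (simp add: mult_inv_mult_cancel)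
  ultimately show ?thesis
    using a closed by (simp add: colour_stab_def comp_def)
qed

text \<open>\<open>F (x \<otimes> g)\<close> is the product of \<open>F g\<close> and the image of
  \<open>x\<close> under the translate of \<open>F\<close> at \<open>g\<close>. Each factor has two
  possible values, so at most four candidates remain for the image.\<close>

lemma rigid_mult:
  assumes "x \<in> rigid c" "g \<in> rigid c" "F \<in> colour_stab c"
  shows "\<exists>a\<in>inv_class G x. \<exists>b\<in>inv_class G g. F (x \<otimes> g) = a \<otimes> b"
proof -
  have carrier: "x \<in> carrier G" "g \<in> carrier G"
    using assms by (auto simp: rigid_def)
  let ?H = "\<lambda>y. F (y \<otimes> g) \<otimes> inv (F g)"
  have "?H \<in> colour_stab c"
    using assms(3) carrier by (intro colour_stab_translate) (auto simp: colour_stab_def)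
  then have "?H x \<in> inv_class G x"
    by (rule rigidD[OF assms(1)])
  moreover have "F g \<in> inv_class G g"
    using assms unfolding rigid_def by blast
  moreover have "F (x \<otimes> g) = ?H x \<otimes> F g"
    using carrier assms(3) by (simp add: colour_stab_closed m_assoc)
  ultimately show ?thesis
    by blast
qed

text \<open>If \<open>g = s \<otimes> t\<close> with rigid \<open>s\<close> and \<open>t\<close>, then only finitely many elements are possible images
  of \<open>g\<close>, so countably many colours suffice to exclude those outside \<open>inv_class G g\<close>.\<close>

lemma rigid_generators_extend:
  assumes S: "S \<subseteq> carrier G" "\<And>s. s \<in> S \<Longrightarrow> inv s \<in> S" and gen: "generate G S = carrier G"
  obtains k :: "'a set \<Rightarrow> nat"
  where "\<And>c :: 'a \<Rightarrow> 'c. S \<subseteq> rigid c \<Longrightarrow>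
    (\<And>g h. g \<in> carrier G \<Longrightarrow> h \<in> carrier G \<Longrightarrow> c g = c h \<Longrightarrow>
      k (inv_class G g) = k (inv_class G h)) \<Longrightarrow> rigid c = carrier G"
proof -
  obtain len :: "'a \<Rightarrow> nat" and s t where dec: "\<And>g. g \<in> carrier G \<Longrightarrow> g \<noteq> \<one> \<Longrightarrow>
      s g \<in> S \<and> t g \<in> carrier G \<and> g = s g \<otimes> t g \<and> len (t g) < len g"
    using word_decomposition[OF assms] by metis
  define images where
    "images g = (\<lambda>(a, b). inv_class G (a \<otimes> b)) ` (inv_class G (s g) \<times> inv_class G (t g))" for g
  \<comment> \<open>A class does not tell which of its elements was decomposed, so the candidates of
    all of them are collected. Infinite sets are not classes; the default \<open>{}\<close> keeps
    their out-degree finite.\<close>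
  define out where "out C = (if finite C then \<Union> (images ` C) else {})" for C
  have "finite (out C)" for C
    by (simp add: out_def images_def inv_class_def)
  then obtain k :: "'a set \<Rightarrow> nat" where k: "\<And>C C'. C' \<in> out C \<Longrightarrow> C' \<noteq> C \<Longrightarrow> k C' \<noteq> k C"
    by (rule finite_outdegree_imp_countable_colouring) (rule that)
  show thesis
  proof (rule that[of k])
    fix c :: "'a \<Rightarrow> 'c"
    assume rig: "S \<subseteq> rigid c"
      and c: "\<And>g h. g \<in> carrier G \<Longrightarrow> h \<in> carrier G \<Longrightarrow> c g = c h \<Longrightarrow>
        k (inv_class G g) = k (inv_class G h)"
    have "g \<in> rigid c" if "g \<in> carrier G" for g
      using that
    proof (induction "len g" arbitrary: g rule: less_induct)
      case less
      show ?case
      proof (cases "g = \<one>")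
        case True
        then show ?thesis
          by (auto simp: rigid_def colour_stab_def inv_class_def)
      next
        case False
        then have g: "s g \<in> S" "t g \<in> carrier G" "s g \<otimes> t g = g" "len (t g) < len g"
          using dec less.prems by auto
        have "F g \<in> inv_class G g" if F: "F \<in> colour_stab c" for F
        proof -
          obtain a b where ab: "a \<in> inv_class G (s g)" "b \<in> inv_class G (t g)" "F g = a \<otimes> b"
            using rigid_mult[of "s g" c "t g" F] F rig less.hyps g by auto
          then have "inv_class G (F g) \<in> images g"
            by (force simp: images_def)
          then have "inv_class G (F g) \<in> \<Union> (images ` inv_class G g)"
            using self_in_inv_class by blast
          moreover have "k (inv_class G (F g)) = k (inv_class G g)"
            using F less.prems by (intro c) (auto simp: colour_stab_closed colour_stab_colour)
          ultimately have "inv_class G (F g) = inv_class G g"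
            using k[of "inv_class G (F g)" "inv_class G g"] by (auto simp: out_def inv_class_def)
          then show ?thesis
            using self_in_inv_class by blast
        qed
        then show ?thesis
          using less.prems by (simp add: rigid_def)
      qed
    qed
    then show "rigid c = carrier G"
      by (auto simp: rigid_def)
  qed
qed

end

subsection \<open>A rigid generating set\<close>

locale well_ordered_group = group G for G (structure) +
  fixes r :: "'a rel"
  assumes r_wf: "wf r" and r_trans: "trans r"
    and r_total: "x \<noteq> y \<Longrightarrow> (x, y) \<in> r \<or> (y, x) \<in> r"
begin

definition below :: "'a \<Rightarrow> 'a set" where
  "below x = generate G {y \<in> carrier G. (y, x) \<in> r}"

definition through :: "'a \<Rightarrow> 'a set" where
  "through x = generate G {y \<in> carrier G. (y, x) \<in> r \<or> y = x}"

text \<open>Layers act like a valuation with values in the well-order: a product of elements of two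
  different layers lies in the later one.\<close>

definition layer :: "'a \<Rightarrow> 'a set" where
  "layer x = through x - below x"

definition irredundant :: "'a set" where
  "irredundant = {x \<in> carrier G. x \<notin> below x}"

text \<open>Closing under inverses makes membership a colour that is constant on inversion
  classes.\<close>

definition irredundant_sym :: "'a set" where
  "irredundant_sym = (\<Union>x\<in>irredundant. inv_class G x)"

lemma subgroup_below: "subgroup (below x) G"
  unfolding below_def by (rule generate_is_subgroup) auto

lemma subgroup_through: "subgroup (through x) G"
  unfolding through_def by (rule generate_is_subgroup) auto

lemma through_subset_below: "(x, y) \<in> r \<Longrightarrow> through x \<subseteq> below y"
  unfolding through_def below_def using r_trans by (intro mono_generate) (auto dest: transD)

lemma below_subset_through: "below x \<subseteq> through x"
  unfolding through_def below_def by (intro mono_generate) auto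

lemma layer_subset_carrier: "layer x \<subseteq> carrier G"
  using subgroup.subset[OF subgroup_through] by (auto simp: layer_def)

lemma layer_inv: "g \<in> layer x \<Longrightarrow> inv g \<in> layer x"
  using subgroup.m_inv_closed[OF subgroup_through] subgroup.m_inv_closed[OF subgroup_below, of "inv g" x]
    layer_subset_carrier
  by (fastforce simp: layer_def)

lemma layer_disjoint: "g \<in> layer x \<Longrightarrow> g \<in> layer y \<Longrightarrow> x = y"
  using r_total[of x y] through_subset_below unfolding layer_def by blast

text \<open>The earlier factor \<open>g\<close> lies in the subgroup \<open>below y\<close>, so
  multiplying by it can move \<open>h\<close> neither into \<open>below y\<close> nor out of
  \<open>through y\<close>.\<close>

lemma layer_mult:
  assumes "(x, y) \<in> r" "g \<in> layer x" "h \<in> layer y"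
  shows "g \<otimes> h \<in> layer y"
proof -
  have g: "g \<in> below y"
    using assms through_subset_below by (auto simp: layer_def)
  have h: "h \<in> through y" "h \<notin> below y"
    using assms(3) by (auto simp: layer_def)
  have carrier: "g \<in> carrier G" "h \<in> carrier G"
    using assms layer_subset_carrier by auto
  have "g \<otimes> h \<notin> below y"
  proof
    assume "g \<otimes> h \<in> below y"
    then have "inv g \<otimes> (g \<otimes> h) \<in> below y"
      using g subgroup_below by (meson subgroup.m_closed subgroup.m_inv_closed)
    then show False
      using h(2) carrier by (simp add: m_assoc[symmetric])
  qed
  moreover have "g \<otimes> h \<in> through y"
    using g h below_subset_through subgroup_through by (meson subgroup.m_closed subsetD)
  ultimately show ?thesis
    by (simp add: layer_def)
qed

lemma layer_diff:
  assumes "(x, y) \<in> r" "g \<in> layer x" "h \<in> layer y"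
  shows "g \<otimes> inv h \<in> layer y" "h \<otimes> inv g \<in> layer y"
proof -
  show *: "g \<otimes> inv h \<in> layer y"
    using assms by (intro layer_mult layer_inv)
  have "inv (g \<otimes> inv h) = h \<otimes> inv g"
    using assms layer_subset_carrier by (simp add: inv_mult_group subset_iff)
  then show "h \<otimes> inv g \<in> layer y"
    using layer_inv[OF *] by simp
qed

lemma inv_class_subset_layer: "x \<in> irredundant \<Longrightarrow> inv_class G x \<subseteq> layer x"
proof -
  assume x: "x \<in> irredundant"
  then have "x \<in> through x"
    unfolding through_def by (intro generate.incl) (simp add: irredundant_def)
  then have "x \<in> layer x"
    using x by (simp add: layer_def irredundant_def)
  then show ?thesis
    by (simp add: inv_class_def layer_inv)
qed

lemma irredundant_subset_carrier: "irredundant \<subseteq> carrier G"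
  by (auto simp: irredundant_def)

lemma irredundant_sym_subset_carrier: "irredundant_sym \<subseteq> carrier G"
  using irredundant_subset_carrier inv_class_subset_carrier by (auto simp: irredundant_sym_def)

lemma irredundant_sym_inv: "g \<in> irredundant_sym \<Longrightarrow> inv g \<in> irredundant_sym"
  using irredundant_subset_carrier by (force simp: irredundant_sym_def inv_class_def)

text \<open>Well-founded induction: an omitted element is generated by its predecessors, which are
  covered already.\<close>

lemma generate_irredundant_sym: "generate G irredundant_sym = carrier G"
proof -
  have "x \<in> generate G irredundant_sym" if "x \<in> carrier G" for x
    using r_wf that
  proof (induction x rule: wf_induct_rule)
    case (less x)
    show ?case
    proof (cases "x \<in> irredundant")
      case True
      then have "x \<in> irredundant_sym"
        using self_in_inv_class by (auto simp: irredundant_sym_def)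
      then show ?thesis
        by (rule generate.incl)
    next
      case False
      then have "x \<in> below x"
        using less.prems by (simp add: irredundant_def)
      moreover have "below x \<subseteq> generate G irredundant_sym"
        unfolding below_def using less.IH irredundant_sym_subset_carrier
        by (intro generate_mono_closure) auto
      ultimately show ?thesis
        by blast
    qed
  qed
  then show ?thesis
    using generate_incl[OF irredundant_sym_subset_carrier] by blast
qed

text \<open>For generators in layers \<open>x \<noteq> y\<close>, the quotient lies in the layer of \<open>max x y\<close>. A parity
  that alternates along the well-order thus lets the colouring compare layers of opposite parity.
  If \<open>x\<close> were the first generator moved, say into layer \<open>y\<close>, then \<open>y\<close> is later than \<open>x\<close> and of the
  same parity, hence beyond the successor \<open>z\<close> of \<open>x\<close>; but the preimage of \<open>z\<close> has to be later than
  \<open>x\<close>, and this comparison is not preserved.\<close>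

lemma irredundant_rigid:
  obtains P where "\<And>g. g \<in> carrier G \<Longrightarrow> inv g \<in> P \<longleftrightarrow> g \<in> P"
    "\<And>c :: 'a \<Rightarrow> 'c. (\<And>g h. g \<in> carrier G \<Longrightarrow> h \<in> carrier G \<Longrightarrow> c g = c h \<Longrightarrow>
      (g \<in> irredundant_sym \<longleftrightarrow> h \<in> irredundant_sym) \<and> (g \<in> P \<longleftrightarrow> h \<in> P)) \<Longrightarrow>
      irredundant_sym \<subseteq> rigid c"
proof -
  obtain p :: "'a \<Rightarrow> bool" where p: "\<And>x y. x \<in> irredundant \<Longrightarrow> y \<in> irredundant \<Longrightarrow> (x, y) \<in> r \<Longrightarrow>
      (\<And>z. z \<in> irredundant \<Longrightarrow> (x, z) \<in> r \<Longrightarrow> (z, y) \<notin> r) \<Longrightarrow> p y \<noteq> p x"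
    using wf_alternating[OF r_wf r_total, of irredundant] by blast
  define P where "P = (\<Union>x\<in>{x \<in> irredundant. p x}. layer x)"
  have P_layer: "g \<in> P \<longleftrightarrow> p x" if "x \<in> irredundant" "g \<in> layer x" for g x
    using that layer_disjoint by (auto simp: P_def)
  have "inv g \<in> P \<longleftrightarrow> g \<in> P" if "g \<in> carrier G" for g
    using that layer_inv inv_inv unfolding P_def by fastforce
  moreover have "irredundant_sym \<subseteq> rigid c"
    if c: "\<And>g h. g \<in> carrier G \<Longrightarrow> h \<in> carrier G \<Longrightarrow> c g = c h \<Longrightarrow>
      (g \<in> irredundant_sym \<longleftrightarrow> h \<in> irredundant_sym) \<and> (g \<in> P \<longleftrightarrow> h \<in> P)" for c :: "'a \<Rightarrow> 'c"
  proof -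
    \<comment> \<open>Both invariants are used: membership in \<open>irredundant_sym\<close> yields
      \<open>y\<close>, and membership in \<open>P\<close> keeps the parity of the layer.\<close>
    have generator: "\<exists>y\<in>irredundant. F u \<in> inv_class G y \<and> F u \<in> layer y \<and> (p y \<longleftrightarrow> p x)"
      if F: "F \<in> colour_stab c" and x: "x \<in> irredundant" "u \<in> inv_class G x" for F u x
    proof -
      have u: "u \<in> irredundant_sym" "u \<in> layer x" "u \<in> carrier G"
        using x inv_class_subset_layer layer_subset_carrier by (auto simp: irredundant_sym_def)
      then have Fu: "F u \<in> irredundant_sym" "F u \<in> P \<longleftrightarrow> u \<in> P"
        using c[of "F u" u] F by (auto simp: colour_stab_closed colour_stab_colour)
      then obtain y where "y \<in> irredundant" "F u \<in> inv_class G y"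
        by (auto simp: irredundant_sym_def)
      then show ?thesis
        using Fu(2) u(2) x(1) P_layer inv_class_subset_layer by blast
    qed
    \<comment> \<open>The induction leaves \<open>F\<close> arbitrary, since the hypothesis is
      needed both for \<open>F\<close> and for its inverse.\<close>
    have fixed: "F u \<in> inv_class G x"
      if "x \<in> irredundant" "u \<in> inv_class G x" "F \<in> colour_stab c" for x u F
      using r_wf that
    proof (induction x arbitrary: u F rule: wf_induct_rule)
      case (less x)
      note x = less.prems(1) and u = less.prems(2) and F = less.prems(3)
      let ?H = "inv_into (carrier G) F"
      have H: "?H \<in> colour_stab c"
        using F by (rule colour_stab_inv_into)
      have bij: "bij_betw F (carrier G) (carrier G)"
        using F by (simp add: colour_stab_def)
      have u_layer: "u \<in> layer x"
        using u x inv_class_subset_layer by blast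
      then have u_carrier: "u \<in> carrier G"
        using layer_subset_carrier by blast
      obtain y where y: "y \<in> irredundant" "F u \<in> inv_class G y" "F u \<in> layer y" "p y \<longleftrightarrow> p x"
        using generator[OF F x u] by blast
      have "x = y"
      proof (rule ccontr)
        assume "x \<noteq> y"
        then consider "(y, x) \<in> r" | "(x, y) \<in> r"
          using r_total by blast
        then show False
        proof cases
          case 1
          \<comment> \<open>The inverse already fixes the class of the earlier generator
            \<open>y\<close>, which would put \<open>u\<close> itself into the layer of
            \<open>y\<close>.\<close>
          have "?H (F u) \<in> inv_class G y"
            using less.IH[OF 1 y(1,2) H] .
          then have "u \<in> layer y"
            using bij_betw_inv_into_left[OF bij u_carrier] inv_class_subset_layer[OF y(1)] by auto
          then show False
            using layer_disjoint u_layer \<open>x \<noteq> y\<close> by blast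
        next
          case 2
          have "y \<in> {z \<in> irredundant. (x, z) \<in> r}"
            using 2 y(1) by simp
          then obtain z where "z \<in> {z \<in> irredundant. (x, z) \<in> r}"
            "\<And>w. (w, z) \<in> r \<Longrightarrow> w \<notin> {z \<in> irredundant. (x, z) \<in> r}"
            by (rule wfE_min[OF r_wf]) (rule that)
          then have z: "z \<in> irredundant" "(x, z) \<in> r"
            "\<And>w. w \<in> irredundant \<Longrightarrow> (x, w) \<in> r \<Longrightarrow> (w, z) \<notin> r"
            by blast+
          have pz: "p z \<noteq> p x"
            by (rule p[OF x z(1,2)]) (rule z(3))
          then have "(z, y) \<in> r"
            using r_total[of z y] z(3)[of y] y(1,4) 2 by auto
          have z_layer: "z \<in> layer z"
            using inv_class_subset_layer[OF z(1)] self_in_inv_class by blast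
          then have z_carrier: "z \<in> carrier G"
            using layer_subset_carrier by blast
          obtain w where w: "w \<in> irredundant" "?H z \<in> inv_class G w" "?H z \<in> layer w" "p w \<longleftrightarrow> p z"
            using generator[OF H z(1) self_in_inv_class] by blast
          have FH: "F (?H z) = z"
            using bij_betw_inv_into_right[OF bij z_carrier] .
          \<comment> \<open>Otherwise the induction hypothesis at \<open>w\<close> keeps
            \<open>F (?H z) = z\<close> in the class of \<open>w\<close>, forcing
            \<open>w = z\<close>, although \<open>z\<close> comes after \<open>x\<close>.\<close>
          have "(w, x) \<notin> r"
          proof
            assume "(w, x) \<in> r"
            then have "z \<in> inv_class G w"
              using less.IH[OF _ w(1,2) F] FH by simp
            then have "w = z"
              using layer_disjoint inv_class_subset_layer[OF w(1)] z_layer by blast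
            then show False
              using \<open>(w, x) \<in> r\<close> z(2) r_wf wf_asym by metis
          qed
          then have "(x, w) \<in> r"
            using r_total[of x w] pz w(4) by auto
          \<comment> \<open>The quotient of \<open>u\<close> and \<open>?H z\<close> has the parity
            of \<open>w\<close>, that is of \<open>z\<close>; the quotient of their images
            \<open>F u\<close> and \<open>z\<close> has the parity of \<open>y\<close>, that is of
            \<open>x\<close>. These parities differ.\<close>
          have "u \<otimes> inv (?H z) \<in> layer w"
            using layer_diff(1)[OF \<open>(x, w) \<in> r\<close> u_layer w(3)] .
          then have "u \<otimes> inv (?H z) \<in> P \<longleftrightarrow> p z"
            using P_layer w by blast
          moreover have "F u \<otimes> inv z \<in> layer y"
            using layer_diff(2)[OF \<open>(z, y) \<in> r\<close> z_layer y(3)] .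
          then have "F u \<otimes> inv z \<in> P \<longleftrightarrow> p x"
            using P_layer y by blast
          moreover have "c (F u \<otimes> inv z) = c (u \<otimes> inv (?H z))"
          proof -
            have "c (F u \<otimes> inv (F (?H z))) = c (u \<otimes> inv (?H z))"
              using F u_carrier colour_stab_closed[OF H z_carrier] by (simp add: colour_stab_def)
            then show ?thesis
              by (simp add: FH)
          qed
          then have "F u \<otimes> inv z \<in> P \<longleftrightarrow> u \<otimes> inv (?H z) \<in> P"
            using c[of "F u \<otimes> inv z" "u \<otimes> inv (?H z)"] colour_stab_closed[OF F u_carrier]
              colour_stab_closed[OF H z_carrier] u_carrier z_carrier
            by simp
          ultimately show False
            using pz by blast
        qed
      qed
      then show ?case
        using y(2) by simp
    qed
    show ?thesis
    proof
      fix u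
      assume u: "u \<in> irredundant_sym"
      then obtain x where x: "x \<in> irredundant" "u \<in> inv_class G x"
        by (auto simp: irredundant_sym_def)
      then have "inv_class G u = inv_class G x"
        using irredundant_subset_carrier by (intro inv_class_eq) auto
      then show "u \<in> rigid c"
        using fixed[OF x] u irredundant_sym_subset_carrier by (auto simp: rigid_def)
    qed
  qed
  ultimately show thesis
    using that by blast
qed

end

section \<open>The combined colouring and its link to \<open>Xi G\<close>\<close>

context group
begin

lemma ex_rigid_colouring:
  obtains c :: "'a \<Rightarrow> nat"
  where "\<And>g. g \<in> carrier G \<Longrightarrow> c (inv g) = c g" "rigid c = carrier G"
proof -
  obtain r :: "'a rel" where "wf r" "trans r" "\<And>x y. x \<noteq> y \<Longrightarrow> (x, y) \<in> r \<or> (y, x) \<in> r"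
    using well_order_UNIV_strict by metis
  then interpret well_ordered_group G r
    by unfold_locales auto
  obtain P where P: "\<And>g. g \<in> carrier G \<Longrightarrow> inv g \<in> P \<longleftrightarrow> g \<in> P"
    "\<And>c :: 'a \<Rightarrow> nat. (\<And>g h. g \<in> carrier G \<Longrightarrow> h \<in> carrier G \<Longrightarrow> c g = c h \<Longrightarrow>
      (g \<in> irredundant_sym \<longleftrightarrow> h \<in> irredundant_sym) \<and> (g \<in> P \<longleftrightarrow> h \<in> P)) \<Longrightarrow>
      irredundant_sym \<subseteq> rigid c"
    using irredundant_rigid by blast
  obtain k :: "'a set \<Rightarrow> nat" where k: "\<And>c :: 'a \<Rightarrow> nat. irredundant_sym \<subseteq> rigid c \<Longrightarrow>
      (\<And>g h. g \<in> carrier G \<Longrightarrow> h \<in> carrier G \<Longrightarrow> c g = c h \<Longrightarrow>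
        k (inv_class G g) = k (inv_class G h)) \<Longrightarrow> rigid c = carrier G"
    using rigid_generators_extend[OF irredundant_sym_subset_carrier irredundant_sym_inv
        generate_irredundant_sym] by blast
  \<comment> \<open>\<open>to_nat\<close> is injective, so equality of \<open>c\<close> gives
    equality of all three components, each of which is invariant under inversion.\<close>
  define c where "c g = to_nat (k (inv_class G g), g \<in> irredundant_sym, g \<in> P)" for g
  show thesis
  proof
    show "rigid c = carrier G"
      by (intro k P(2)) (auto simp: c_def)
    show "c (inv g) = c g" if g: "g \<in> carrier G" for g
    proof -
      have "inv_class G (inv g) = inv_class G g"
        using g by (auto simp: inv_class_def)
      moreover have "inv g \<in> irredundant_sym \<longleftrightarrow> g \<in> irredundant_sym"
        using irredundant_sym_inv[of g] irredundant_sym_inv[of "inv g"] g by auto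
      ultimately show ?thesis
        using P(1) g by (simp add: c_def)
    qed
  qed
qed

text \<open>One direction is the invariance of \<open>c\<close> under inversion. For the other,
  translating \<open>F\<close> at \<open>y\<close> gives a member of \<open>colour_stab c\<close>,
  and rigidity is applied to the element \<open>x \<otimes> inv y\<close>.\<close>

lemma colour_preserving_iff_Xi:
  assumes c: "\<And>g. g \<in> carrier G \<Longrightarrow> c (inv g) = c g" and rig: "rigid c = carrier G"
  shows "F \<in> Xi G \<longleftrightarrow> F \<in> Bij (carrier G) \<and>
    (\<forall>x\<in>carrier G. \<forall>y\<in>carrier G. c (F x \<otimes> inv (F y)) = c (x \<otimes> inv y))"
proof (intro iffI conjI ballI; (elim conjE)?)
  assume F: "F \<in> Xi G"
  then show "F \<in> Bij (carrier G)"
    by (simp add: Xi_def)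
  fix x y
  assume xy: "x \<in> carrier G" "y \<in> carrier G"
  then have "inv_class G (F x \<otimes> inv (F y)) = inv_class G (x \<otimes> inv y)"
    using F by (simp add: Xi_def)
  then have "F x \<otimes> inv (F y) \<in> inv_class G (x \<otimes> inv y)"
    using self_in_inv_class by blast
  then show "c (F x \<otimes> inv (F y)) = c (x \<otimes> inv y)"
    using xy c[of "x \<otimes> inv y"] by (auto simp: inv_class_def)
next
  assume F: "F \<in> Bij (carrier G)"
    and F_c: "\<forall>x\<in>carrier G. \<forall>y\<in>carrier G. c (F x \<otimes> inv (F y)) = c (x \<otimes> inv y)"
  have "inv_class G (F x \<otimes> inv (F y)) = inv_class G (x \<otimes> inv y)"
    if xy: "x \<in> carrier G" "y \<in> carrier G" for x y
  proof (rule inv_class_eq)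
    let ?H = "\<lambda>z. F (z \<otimes> y) \<otimes> inv (F y)"
    have "?H \<in> colour_stab c"
      using F F_c xy by (intro colour_stab_translate) (auto simp: Bij_def)
    moreover have "x \<otimes> inv y \<in> rigid c"
      using xy rig by simp
    ultimately have "?H (x \<otimes> inv y) \<in> inv_class G (x \<otimes> inv y)"
      by (rule rigidD[rotated])
    then show "F x \<otimes> inv (F y) \<in> inv_class G (x \<otimes> inv y)"
      using xy by (simp add: m_assoc)
  qed (use xy in simp)
  then show "F \<in> Xi G"
    using F by (simp add: Xi_def)
qed

end

section \<open>From the colouring to the metric\<close>

text \<open>A Cauchy sequence is eventually constant: late terms are closer than the least nonzero
  distance allows.\<close>

lemma mcomplete_if_uniformly_discrete:
  assumes "Metric_space M d" "uniformly_discrete M d"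
  shows "Metric_space.mcomplete M d"
proof -
  interpret Metric_space M d
    by fact
  obtain e where e: "e > 0" "\<And>x y. x \<in> M \<Longrightarrow> y \<in> M \<Longrightarrow> d x y \<noteq> 0 \<Longrightarrow> e \<le> d x y"
    using assms(2) by (auto simp: uniformly_discrete_def)
  have "\<exists>x. limitin mtopology \<sigma> x sequentially" if Cauchy: "MCauchy \<sigma>" for \<sigma>
  proof -
    have \<sigma>: "\<sigma> n \<in> M" for n
      using Cauchy by (auto simp: MCauchy_def)
    obtain N where N: "\<forall>n m. N \<le> n \<longrightarrow> N \<le> m \<longrightarrow> d (\<sigma> n) (\<sigma> m) < e"
      using Cauchy e(1) unfolding MCauchy_def by blast
    have zero_tail: "d (\<sigma> n) (\<sigma> N) = 0" if "N \<le> n" for n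
      using e(2)[OF \<sigma> \<sigma>, of n N] N that by (meson leD order_refl)
    have "\<forall>n\<ge>N. \<sigma> n \<in> M \<and> d (\<sigma> n) (\<sigma> N) < \<epsilon>" if "\<epsilon> > 0" for \<epsilon>
      using that zero_tail \<sigma> by metis
    then have "limitin mtopology \<sigma> (\<sigma> N) sequentially"
      unfolding limit_metric_sequentially using \<sigma> by blast
    then show ?thesis ..
  qed
  then show ?thesis
    by (simp add: mcomplete_def)
qed

theorem theorem1p4:
  fixes G :: "('a, 'b) monoid_scheme"
  assumes "group G"
  shows "\<exists>d :: 'a \<Rightarrow> 'a \<Rightarrow> real.
    Metric_space (carrier G) d \<and>
    right_invariant G d \<and>
    Isom (carrier G) d = Xi G \<and>
    (\<lambda>(x, y). d x y) ` (carrier G \<times> carrier G) \<subseteq>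
      {0} \<union> {1 + 2 powi (- j) | j :: int. 1 \<le> j} \<and>
    Metric_space.mbounded (carrier G) d (carrier G) \<and>
    uniformly_discrete (carrier G) d \<and>
    Metric_space.mcomplete (carrier G) d"
proof -
  interpret group G
    by fact
  obtain c :: "'a \<Rightarrow> nat" where c: "\<And>g. g \<in> carrier G \<Longrightarrow> c (inv\<^bsub>G\<^esub> g) = c g" "rigid c = carrier G"
    using ex_rigid_colouring by blast
  \<comment> \<open>The shift by 1 makes the exponents start at \<open>j = 1\<close>. Injectivity of
    \<open>v\<close> lets distances determine colours.\<close>
  define v :: "nat \<Rightarrow> real" where "v n = 1 + 2 powi (- (1 + int n))" for n
  have v_alt: "v n = 1 + (1 / 2) ^ Suc n" for n
  proof -
    have "(2 :: real) powi (- int (Suc n)) = (1 / 2) ^ Suc n"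
      by (simp only: power_int_minus power_int_of_nat power_one_over inverse_eq_divide)
    then show ?thesis
      by (simp add: v_def)
  qed
  have v_range: "1 < v n" "v n \<le> 2" for n
    using power_le_one[of "1 / 2 :: real" "Suc n"] by (auto simp: v_alt simp del: power_Suc)
  have v_inj: "v m = v n \<longleftrightarrow> m = n" for m n
    using power_inject_exp'[of "1 / 2 :: real" "Suc m" "Suc n"] by (simp add: v_alt del: power_Suc)
  have v_pos: "0 \<le> v n" "v n \<noteq> 0" for n
    using v_range(1)[of n] by linarith+
  \<comment> \<open>\<open>Metric_space\<close> demands symmetry and nonnegativity on the whole
    type, hence the default 0 outside the carrier.\<close>
  define d where "d x y = (if x \<in> carrier G \<and> y \<in> carrier G \<and> x \<noteq> y
    then v (c (x \<otimes>\<^bsub>G\<^esub> inv\<^bsub>G\<^esub> y)) else 0)" for x y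
  have d_eq: "d x y = (if x = y then 0 else v (c (x \<otimes>\<^bsub>G\<^esub> inv\<^bsub>G\<^esub> y)))"
    if "x \<in> carrier G" "y \<in> carrier G" for x y
    using that by (simp add: d_def)
  have d_sym: "d x y = d y x" for x y
  proof (cases "x \<in> carrier G \<and> y \<in> carrier G")
    case True
    then have "y \<otimes>\<^bsub>G\<^esub> inv\<^bsub>G\<^esub> x = inv\<^bsub>G\<^esub> (x \<otimes>\<^bsub>G\<^esub> inv\<^bsub>G\<^esub> y)"
      by (simp add: inv_mult_group)
    then show ?thesis
      using True c(1)[of "x \<otimes>\<^bsub>G\<^esub> inv\<^bsub>G\<^esub> y"] by (simp add: d_eq)
  qed (auto simp: d_def)
  have metric: "Metric_space (carrier G) d"
  proof
    show "d x z \<le> d x y + d y z"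
      if "x \<in> carrier G" "y \<in> carrier G" "z \<in> carrier G" for x y z
      using that v_range(2)[of "c (x \<otimes>\<^bsub>G\<^esub> inv\<^bsub>G\<^esub> z)"]
        v_range(1)[of "c (x \<otimes>\<^bsub>G\<^esub> inv\<^bsub>G\<^esub> y)"] v_range(1)[of "c (y \<otimes>\<^bsub>G\<^esub> inv\<^bsub>G\<^esub> z)"]
      by (auto simp: d_eq)
    show "d x y = d y x" for x y
      by (rule d_sym)
  qed (auto simp: d_def v_pos)
  interpret Metric_space "carrier G" d
    by (rule metric)
  have "right_invariant G d"
    unfolding right_invariant_def by (auto simp: d_eq mult_inv_mult_cancel)
  moreover have "F \<in> Isom (carrier G) d \<longleftrightarrow> F \<in> Bij (carrier G) \<and>
      (\<forall>x\<in>carrier G. \<forall>y\<in>carrier G. c (F x \<otimes>\<^bsub>G\<^esub> inv\<^bsub>G\<^esub> (F y)) = c (x \<otimes>\<^bsub>G\<^esub> inv\<^bsub>G\<^esub> y))" for F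
  proof -
    \<comment> \<open>\<open>Isom\<close> asks only for surjectivity, while \<open>Bij\<close> also
      needs injectivity; it follows because points with equal images have distance 0.\<close>
    have "inj_on F (carrier G)" if "F \<in> Isom (carrier G) d"
    proof (rule inj_onI)
      fix x y
      assume xy: "x \<in> carrier G" "y \<in> carrier G" "F x = F y"
      then have "d (F x) (F y) = d x y"
        using that unfolding Isom_def by blast
      moreover have "F x \<in> carrier G"
        using that xy by (auto simp: Isom_def)
      then have "d (F x) (F y) = 0"
        using xy by simp
      ultimately show "x = y"
        using xy by simp
    qed
    then have "F \<in> Isom (carrier G) d \<longleftrightarrow> F \<in> Bij (carrier G) \<and>
        (\<forall>x\<in>carrier G. \<forall>y\<in>carrier G. d (F x) (F y) = d x y)"
      by (auto simp: Isom_def Bij_def bij_betw_def)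
    moreover have "d (F x) (F y) = d x y \<longleftrightarrow>
        c (F x \<otimes>\<^bsub>G\<^esub> inv\<^bsub>G\<^esub> (F y)) = c (x \<otimes>\<^bsub>G\<^esub> inv\<^bsub>G\<^esub> y)"
      if "F \<in> Bij (carrier G)" "x \<in> carrier G" "y \<in> carrier G" for x y
    proof -
      have "F x \<in> carrier G" "F y \<in> carrier G" "F x = F y \<longleftrightarrow> x = y"
        using that by (auto simp: Bij_def bij_betw_def inj_on_def)
      then show ?thesis
        using that by (auto simp: d_eq v_inj)
    qed
    ultimately show ?thesis
      by blast
  qed
  then have "Isom (carrier G) d = Xi G"
    using colour_preserving_iff_Xi[OF c] by blast
  moreover have "(\<lambda>(x, y). d x y) ` (carrier G \<times> carrier G) \<subseteq>
      {0} \<union> {1 + 2 powi (- j) | j :: int. 1 \<le> j}"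
  proof -
    have "v n \<in> {1 + 2 powi (- j) | j :: int. 1 \<le> j}" for n
      unfolding v_def by (intro CollectI exI[of _ "1 + int n"]) simp
    then show ?thesis
      by (auto simp: d_def)
  qed
  moreover have "mbounded (carrier G)"
    unfolding mbounded_alt using v_range(2) by (auto simp: d_def intro!: exI[of _ 2])
  moreover have "uniformly_discrete (carrier G) d"
    unfolding uniformly_discrete_def using less_imp_le[OF v_range(1)]
    by (auto simp: d_def intro!: exI[of _ 1])
  ultimately show ?thesis
    using metric mcomplete_if_uniformly_discrete by blast
qed

end
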